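(* Let $\mathbf{k}$ be a unitary commutative ring and let $\lambda\in\mathbf{k}$. (a) Assume that $\lambda$ is invertible. A $\mathbf{k}$-linear operator $p$ on a $\mathbf{k}$-module $M$ is quasi-idempotent of weight $\lambda$ if and only if there is a $\mathbf{k}$-module decomposition $M=M'\oplus M''$ such that $p$ is the $-\lambda$ multiple of the projection from $M$ to $M'$ along $M''$, i.e. $p(x'+x'')=-\lambda x'$ for all $x'\in M'$, $x''\in M''$. If either of the two equivalent conditions holds, then $M'=M_{-\lambda}$ and $M''=M_0$. (b) Let $(R,P)$ be a Rota-Baxter algebra of weight $\lambda$ and let $(M,p)$ be an $(R,P)$-module. Then $p$ is quasi-idempotent of weight $\lambda$ if and only if $p(P(1)x)=P(1)p(x)$ for all $x\in M$. In the case when $(M,p)=(R,P)$, $P$ is quasi-idempotent of weight $\lambda$ if and only if $P(uP(1))=P(u)P(1)$ for all $u\in R$. (c) Assume that $\lambda$ is invertible. A $\mathbf{k}$-linear operator $P$ on a $\mathbf{k}$-algebra $R$ is a quasi-idempotent Rota-Baxter operator of weight $\lambda$ if and only if there is a $\mathbf{k}$-module decomposition $R=R'\oplus R''$ of $R$ into nonunitary subalgebras $R'$ and $R''$ such that $P$ is the $-\lambda$ multiple of the projection of $R$ to $R'$ along $R''$, i.e. $P(x'+x'')=-\lambda x'$ for all $x'\in R'$, $x''\in R''$. If either of the two equivalent conditions holds, then $R'=R_{-\lambda}$ and $R''=R_0$. (d) Assume that $\lambda$ is invertible. Let $P:R\to R$ be a quasi-idempotent Rota-Baxter operator of weight $\lambda$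 on a $\mathbf{k}$-algebra $R$, with the decomposition $R=R_{-\lambda}\oplus R_0$. Let $M$ be an $R$-module and let $p:M\to M$ be a quasi-idempotent $\mathbf{k}$-linear operator of weight $\lambda$. Then $(M,p)$ is an $(R,P)$-module if and only if the eigenspace $M_{-\lambda}$ is an $R_{-\lambda}$-module and the eigenspace $M_0$ is an $R_0$-module.
   Context: All algebras are unitary associative $\mathbf{k}$-algebras; a nonunitary algebra (or subalgebra) is an associative algebra which might not have an identity (a $\mathbf{k}$-submodule closed under multiplication). A Rota-Baxter algebra of weight $\lambda$ is a pair $(R,P)$ with $R$ a $\mathbf{k}$-algebra and $P:R\to R$ a $\mathbf{k}$-linear map (a Rota-Baxter operator of weight $\lambda$) with $P(x)P(y)=P(xP(y))+P(P(x)y)+\lambda P(xy)$ for all $x,y\in R$. A (left) $(R,P)$-module is a pair $(M,p)$ with $M$ a left $R$-module and $p:M\to M$ a $\mathbf{k}$-linear map such that $P(a)p(x)=p(ap(x))+p(P(a)x)+\lambda p(ax)$ for all $a\in R$, $x\in M$. A $\mathbf{k}$-linear operator $p$ on $M$ is quasi-idempotent of weight $\lambda$ if $p^2+\lambda p=0$; similarly a Rota-Baxter operator $P$ of weight $\lambda$ is quasi-idempotent if $P^2+\lambda P=0$. For $\mu\in\mathbf{k}$, $M_\mu=\{x\in M\mid p(x)=\mu x\}$, and $R_\mu=\{x\in R\mid P(x)=\mu x\}$. In (d), "$M_{-\lambda}$ is an $R_{-\lambda}$-module" means that it is stable under the restricted action, $R_{-\lambda}M_{-\lambda}\subseteq M_{-\lambda}$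 (where $R_{-\lambda}$ is a nonunitary algebra), and similarly $R_0M_0\subseteq M_0$. *)

theory Defs
  imports "HOL-Algebra.Module" "HOL-Algebra.AbelCoset"
begin

text \<open>The library locale \<^locale>\<open>algebra\<close> only covers commutative algebras, and
  \<^locale>\<open>module\<close> only modules over commutative rings; the two locales below drop commutativity.
  As everywhere in HOL-Algebra, the zero ring is allowed, and the multiplicative fields of a record
  that is used merely as a module are irrelevant.\<close>

locale assoc_algebra = module K R + ring R
  for K :: "('k, 'c) ring_scheme" and R :: "('k, 'r, 'd) module_scheme" +
  assumes smult_mult_left:
      "\<lbrakk>c \<in> carrier K; x \<in> carrier R; y \<in> carrier R\<rbrakk> \<Longrightarrow>
        (c \<odot>\<^bsub>R\<^esub> x) \<otimes>\<^bsub>R\<^esub> y = c \<odot>\<^bsub>R\<^esub> (x \<otimes>\<^bsub>R\<^esub> y)"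
    and smult_mult_right:
      "\<lbrakk>c \<in> carrier K; x \<in> carrier R; y \<in> carrier R\<rbrakk> \<Longrightarrow>
        x \<otimes>\<^bsub>R\<^esub> (c \<odot>\<^bsub>R\<^esub> y) = c \<odot>\<^bsub>R\<^esub> (x \<otimes>\<^bsub>R\<^esub> y)"

locale left_module = R?: ring R + M?: abelian_group M
  for R :: "('r, 'c) ring_scheme" and M :: "('r, 'm, 'd) module_scheme" +
  assumes smult_closed:
      "\<lbrakk>a \<in> carrier R; x \<in> carrier M\<rbrakk> \<Longrightarrow> a \<odot>\<^bsub>M\<^esub> x \<in> carrier M"
    and smult_l_distr:
      "\<lbrakk>a \<in> carrier R; b \<in> carrier R; x \<in> carrier M\<rbrakk> \<Longrightarrow>
        (a \<oplus>\<^bsub>R\<^esub> b) \<odot>\<^bsub>M\<^esub> x = (a \<odot>\<^bsub>M\<^esub> x) \<oplus>\<^bsub>M\<^esub> (b \<odot>\<^bsub>M\<^esub> x)"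
    and smult_r_distr:
      "\<lbrakk>a \<in> carrier R; x \<in> carrier M; y \<in> carrier M\<rbrakk> \<Longrightarrow>
        a \<odot>\<^bsub>M\<^esub> (x \<oplus>\<^bsub>M\<^esub> y) = (a \<odot>\<^bsub>M\<^esub> x) \<oplus>\<^bsub>M\<^esub> (a \<odot>\<^bsub>M\<^esub> y)"
    and smult_assoc:
      "\<lbrakk>a \<in> carrier R; b \<in> carrier R; x \<in> carrier M\<rbrakk> \<Longrightarrow>
        (a \<otimes>\<^bsub>R\<^esub> b) \<odot>\<^bsub>M\<^esub> x = a \<odot>\<^bsub>M\<^esub> (b \<odot>\<^bsub>M\<^esub> x)"
    and smult_one:
      "x \<in> carrier M \<Longrightarrow> \<one>\<^bsub>R\<^esub> \<odot>\<^bsub>M\<^esub> x = x"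

text \<open>A left module over a \<open>K\<close>-algebra \<open>R\<close> is a \<open>K\<close>-module through the structure map
  \<open>c \<mapsto> c 1\<close> of \<open>R\<close>; \<open>K\<close>-linearity of operators on such a module refers to this structure.
  A record update cannot change the type of scalars, so the record is rebuilt.\<close>

definition restrict_scalars ::
    "('k, 'r, 'd) module_scheme \<Rightarrow> ('r, 'm, 'e) module_scheme \<Rightarrow> ('k, 'm) module" where
  "restrict_scalars R M =
    \<lparr>carrier = carrier M, mult = mult M, one = one M, zero = zero M, add = add M,
     smult = (\<lambda>c x. (c \<odot>\<^bsub>R\<^esub> \<one>\<^bsub>R\<^esub>) \<odot>\<^bsub>M\<^esub> x)\<rparr>"

definition linear_operator ::
    "('k, 'c) ring_scheme \<Rightarrow> ('k, 'm, 'd) module_scheme \<Rightarrow> ('m \<Rightarrow> 'm) \<Rightarrow> bool" where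
  "linear_operator K M p \<longleftrightarrow>
    p \<in> carrier M \<rightarrow> carrier M \<and>
    (\<forall>x\<in>carrier M. \<forall>y\<in>carrier M. p (x \<oplus>\<^bsub>M\<^esub> y) = p x \<oplus>\<^bsub>M\<^esub> p y) \<and>
    (\<forall>c\<in>carrier K. \<forall>x\<in>carrier M. p (c \<odot>\<^bsub>M\<^esub> x) = c \<odot>\<^bsub>M\<^esub> p x)"

definition quasi_idempotent :: "'k \<Rightarrow> ('k, 'm, 'd) module_scheme \<Rightarrow> ('m \<Rightarrow> 'm) \<Rightarrow> bool" where
  "quasi_idempotent l M p \<longleftrightarrow>
    (\<forall>x\<in>carrier M. p (p x) \<oplus>\<^bsub>M\<^esub> (l \<odot>\<^bsub>M\<^esub> p x) = \<zero>\<^bsub>M\<^esub>)"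

definition eigenspace :: "('k, 'm, 'd) module_scheme \<Rightarrow> ('m \<Rightarrow> 'm) \<Rightarrow> 'k \<Rightarrow> 'm set" where
  "eigenspace M p \<mu> = {x \<in> carrier M. p x = \<mu> \<odot>\<^bsub>M\<^esub> x}"

definition module_decomposition ::
    "('k, 'c) ring_scheme \<Rightarrow> ('k, 'm, 'd) module_scheme \<Rightarrow> 'm set \<Rightarrow> 'm set \<Rightarrow> bool" where
  "module_decomposition K M M' M'' \<longleftrightarrow>
    submodule M' K M \<and> submodule M'' K M \<and>
    M' <+>\<^bsub>M\<^esub> M'' = carrier M \<and> M' \<inter> M'' = {\<zero>\<^bsub>M\<^esub>}"

text \<open>\<open>p\<close> is the \<open>\<mu>\<close> multiple of the projection to \<open>M'\<close> along \<open>M''\<close>.\<close>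

definition multiple_of_projection ::
    "'k \<Rightarrow> ('k, 'm, 'd) module_scheme \<Rightarrow> 'm set \<Rightarrow> 'm set \<Rightarrow> ('m \<Rightarrow> 'm) \<Rightarrow> bool" where
  "multiple_of_projection \<mu> M M' M'' p \<longleftrightarrow>
    (\<forall>x'\<in>M'. \<forall>x''\<in>M''. p (x' \<oplus>\<^bsub>M\<^esub> x'') = \<mu> \<odot>\<^bsub>M\<^esub> x')"

definition nonunitary_subalgebra ::
    "('k, 'c) ring_scheme \<Rightarrow> ('k, 'r, 'd) module_scheme \<Rightarrow> 'r set \<Rightarrow> bool" where
  "nonunitary_subalgebra K R S \<longleftrightarrow>
    submodule S K R \<and> (\<forall>x\<in>S. \<forall>y\<in>S. x \<otimes>\<^bsub>R\<^esub> y \<in> S)"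

definition rota_baxter_operator ::
    "('k, 'c) ring_scheme \<Rightarrow> 'k \<Rightarrow> ('k, 'r, 'd) module_scheme \<Rightarrow> ('r \<Rightarrow> 'r) \<Rightarrow> bool" where
  "rota_baxter_operator K l R P \<longleftrightarrow>
    linear_operator K R P \<and>
    (\<forall>x\<in>carrier R. \<forall>y\<in>carrier R.
      P x \<otimes>\<^bsub>R\<^esub> P y =
        P (x \<otimes>\<^bsub>R\<^esub> P y) \<oplus>\<^bsub>R\<^esub> P (P x \<otimes>\<^bsub>R\<^esub> y) \<oplus>\<^bsub>R\<^esub> (l \<odot>\<^bsub>R\<^esub> P (x \<otimes>\<^bsub>R\<^esub> y)))"

definition rota_baxter_algebra ::
    "('k, 'c) ring_scheme \<Rightarrow> 'k \<Rightarrow> ('k, 'r, 'd) module_scheme \<Rightarrow> ('r \<Rightarrow> 'r) \<Rightarrow> bool" where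
  "rota_baxter_algebra K l R P \<longleftrightarrow> assoc_algebra K R \<and> rota_baxter_operator K l R P"

definition rota_baxter_module ::
    "('k, 'c) ring_scheme \<Rightarrow> 'k \<Rightarrow> ('k, 'r, 'd) module_scheme \<Rightarrow> ('r \<Rightarrow> 'r) \<Rightarrow>
      ('r, 'm, 'e) module_scheme \<Rightarrow> ('m \<Rightarrow> 'm) \<Rightarrow> bool" where
  "rota_baxter_module K l R P M p \<longleftrightarrow>
    left_module R M \<and> linear_operator K (restrict_scalars R M) p \<and>
    (\<forall>a\<in>carrier R. \<forall>x\<in>carrier M.
      P a \<odot>\<^bsub>M\<^esub> p x =
        p (a \<odot>\<^bsub>M\<^esub> p x) \<oplus>\<^bsub>M\<^esub> p (P a \<odot>\<^bsub>M\<^esub> x) \<oplus>\<^bsub>M\<^esub>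
        (l \<odot>\<^bsub>restrict_scalars R M\<^esub> p (a \<odot>\<^bsub>M\<^esub> x)))"

definition stable_under :: "('r, 'm, 'd) module_scheme \<Rightarrow> 'r set \<Rightarrow> 'm set \<Rightarrow> bool" where
  "stable_under M S N \<longleftrightarrow> (\<forall>a\<in>S. \<forall>x\<in>N. a \<odot>\<^bsub>M\<^esub> x \<in> N)"

end

theory Submission
  imports Defs
begin

text \<open>A quasi-idempotent \<open>p\<close> acts as \<open>-l\<close> on its image, so for invertible \<open>l\<close> every \<open>x\<close> splits as
  \<open>-(1/l) p x\<close>, an eigenvector for \<open>-l\<close>, plus \<open>x + (1/l) p x\<close>, which \<open>p\<close> kills. The Rota-Baxter
  identity, for algebras as for modules, is biadditive in its two arguments; hence it may be
  checked on pairs of eigenvectors. It holds automatically on the mixed pairs, and on the other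
  two kinds of pairs it says that the corresponding eigenspaces are stable. The identity at \<open>a = 1\<close>
  gives the criterion in (b).\<close>

section \<open>Rearranging sums of three terms in abelian groups\<close>

text \<open>Tailored to the Rota-Baxter identity with one argument equal to the unit:
  \<open>a\<close> is the product on the left, \<open>b\<close> and \<open>c\<close> become the two
  terms of quasi-idempotency, and \<open>d\<close> is the remaining term.\<close>

lemma (in abelian_group) add_outer_eq_zero_iff:
  assumes "a \<in> carrier G" "b \<in> carrier G" "c \<in> carrier G" "a = b \<oplus> d \<oplus> c" "d \<in> carrier G"
  shows "b \<oplus> c = \<zero> \<longleftrightarrow> d = a"
proof -
  have "a = d \<oplus> (b \<oplus> c)"
    using assms by (simp add: a_ac)
  then show ?thesis
    using assms(1-3,5) by (auto simp: eq_commute[of d])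
qed

text \<open>Merges the right sides of two Rota-Baxter identities when these are added.\<close>

lemma (in abelian_monoid) add3_add3:
  assumes "a \<in> carrier G" "b \<in> carrier G" "c \<in> carrier G"
    and "d \<in> carrier G" "e \<in> carrier G" "f \<in> carrier G"
  shows "(a \<oplus> b \<oplus> c) \<oplus> (d \<oplus> e \<oplus> f) = (a \<oplus> d) \<oplus> (b \<oplus> e) \<oplus> (c \<oplus> f)"
  using assms by (simp add: a_ac)

section \<open>Linear operators, their eigenspaces and quasi-idempotency\<close>

locale linear_endomorphism = module K M
  for K :: "('k, 'c) ring_scheme" (structure) and M :: "('k, 'm, 'd) module_scheme" (structure) +
  fixes p :: "'m \<Rightarrow> 'm"
  assumes linear: "linear_operator K M p"
begin

lemma op_closed [simp, intro]: "x \<in> carrier M \<Longrightarrow> p x \<in> carrier M"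
  using linear by (auto simp: linear_operator_def)

lemma op_add:
  "x \<in> carrier M \<Longrightarrow> y \<in> carrier M \<Longrightarrow> p (x \<oplus>\<^bsub>M\<^esub> y) = p x \<oplus>\<^bsub>M\<^esub> p y"
  using linear by (auto simp: linear_operator_def)

lemma op_smult: "c \<in> carrier K \<Longrightarrow> x \<in> carrier M \<Longrightarrow> p (c \<odot>\<^bsub>M\<^esub> x) = c \<odot>\<^bsub>M\<^esub> p x"
  using linear by (auto simp: linear_operator_def)

lemma op_zero [simp]: "p \<zero>\<^bsub>M\<^esub> = \<zero>\<^bsub>M\<^esub>"
  using op_smult[of "\<zero>\<^bsub>K\<^esub>" "\<zero>\<^bsub>M\<^esub>"] by simp

lemma op_neg: "x \<in> carrier M \<Longrightarrow> p (\<ominus>\<^bsub>M\<^esub> x) = \<ominus>\<^bsub>M\<^esub> p x"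
  using op_add[of x "\<ominus>\<^bsub>M\<^esub> x"] by (metis M.a_inv_closed M.minus_equality M.a_comm M.r_neg op_closed op_zero)

lemma Units_smult_cancel:
  assumes "l \<in> Units K" "x \<in> carrier M" "y \<in> carrier M" "l \<odot>\<^bsub>M\<^esub> x = l \<odot>\<^bsub>M\<^esub> y"
  shows "x = y"
  using assms by (metis Units_closed Units_inv_closed Units_l_inv smult_assoc1 smult_one)

lemma Units_smult_eq_iff:
  assumes "l \<in> Units K" "x \<in> carrier M" "y \<in> carrier M"
  shows "l \<odot>\<^bsub>M\<^esub> x = l \<odot>\<^bsub>M\<^esub> y \<longleftrightarrow> x = y"
  by (rule iffI, erule Units_smult_cancel[OF assms], simp only:)

text \<open>Negating both sides reduces this to cancelling \<open>l\<close> itself, which avoids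
  showing that the eigenvalue \<open>-l\<close> is a unit as well.\<close>

lemma Units_neg_smult_cancel:
  assumes "l \<in> Units K" "x \<in> carrier M" "y \<in> carrier M"
    and "\<ominus>\<^bsub>K\<^esub> l \<odot>\<^bsub>M\<^esub> x = \<ominus>\<^bsub>K\<^esub> l \<odot>\<^bsub>M\<^esub> y"
  shows "x = y"
proof -
  have "\<ominus>\<^bsub>M\<^esub> (\<ominus>\<^bsub>K\<^esub> l \<odot>\<^bsub>M\<^esub> x) = \<ominus>\<^bsub>M\<^esub> (\<ominus>\<^bsub>K\<^esub> l \<odot>\<^bsub>M\<^esub> y)"
    by (simp only: assms(4))
  then have "l \<odot>\<^bsub>M\<^esub> x = l \<odot>\<^bsub>M\<^esub> y"
    using assms(1-3) by (simp add: smult_l_minus Units_closed)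
  then show ?thesis
    by (rule Units_smult_cancel[OF assms(1-3)])
qed

lemma quasi_idempotent_iff:
  assumes "l \<in> carrier K"
  shows "quasi_idempotent l M p \<longleftrightarrow> (\<forall>x\<in>carrier M. p (p x) = \<ominus>\<^bsub>K\<^esub> l \<odot>\<^bsub>M\<^esub> p x)"
proof -
  have "p (p x) \<oplus>\<^bsub>M\<^esub> l \<odot>\<^bsub>M\<^esub> p x = \<zero>\<^bsub>M\<^esub> \<longleftrightarrow> p (p x) = \<ominus>\<^bsub>K\<^esub> l \<odot>\<^bsub>M\<^esub> p x"
    if "x \<in> carrier M" for x
    using that assms
    by (metis M.l_neg M.minus_equality op_closed smult_closed smult_l_minus)
  then show ?thesis
    by (simp add: quasi_idempotent_def)
qed

lemma eigenspace_submodule: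
  assumes "c \<in> carrier K"
  shows "submodule (eigenspace M p c) K M"
proof (rule submoduleI)
  fix a x
  assume "a \<in> carrier K" "x \<in> eigenspace M p c"
  \<comment> \<open>The scalar \<open>a\<close> and the eigenvalue \<open>c\<close> have to change
    places, so the commutativity of \<open>K\<close> is used here.\<close>
  then show "a \<odot>\<^bsub>M\<^esub> x \<in> eigenspace M p c"
    using assms by (auto simp: eigenspace_def op_smult smult_assoc1[symmetric] R.m_comm)
qed (use assms in \<open>auto simp: eigenspace_def op_add op_neg smult_r_distr smult_r_minus\<close>)

text \<open>Serves twice: for the direct sum decomposition, and later for reducing the Rota-Baxter
  identity to eigenvectors.\<close>

lemma eigen_split:
  assumes l: "l \<in> Units K" and qi: "quasi_idempotent l M p" and x: "x \<in> carrier M"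
  obtains x' x'' where "x' \<in> eigenspace M p (\<ominus>\<^bsub>K\<^esub> l)" "x'' \<in> eigenspace M p \<zero>\<^bsub>K\<^esub>"
    "x = x' \<oplus>\<^bsub>M\<^esub> x''"
proof -
  define m where "m = inv\<^bsub>K\<^esub> l"
  have [simp]: "l \<in> carrier K" "m \<in> carrier K"
    using l by (auto simp: m_def)
  have ml: "m \<odot>\<^bsub>M\<^esub> (l \<odot>\<^bsub>M\<^esub> y) = y" "l \<odot>\<^bsub>M\<^esub> (m \<odot>\<^bsub>M\<^esub> y) = y" if "y \<in> carrier M" for y
    using that l by (simp_all add: m_def smult_assoc1[symmetric])
  have pp: "p (p x) = \<ominus>\<^bsub>M\<^esub> (l \<odot>\<^bsub>M\<^esub> p x)"
    using qi x quasi_idempotent_iff[of l] by (simp add: smult_l_minus)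
  \<comment> \<open>The first summand is a multiple of a value of \<open>p\<close>, hence an
    eigenvector for \<open>-l\<close>. The second is killed because
    \<open>p (m p x) = - m l p x = - p x\<close>.\<close>
  let ?x' = "\<ominus>\<^bsub>M\<^esub> (m \<odot>\<^bsub>M\<^esub> p x)" and ?x'' = "m \<odot>\<^bsub>M\<^esub> p x \<oplus>\<^bsub>M\<^esub> x"
  have "?x' \<in> eigenspace M p (\<ominus>\<^bsub>K\<^esub> l)"
    using x by (simp add: eigenspace_def op_neg op_smult pp smult_r_minus smult_l_minus ml)
  moreover have "?x'' \<in> eigenspace M p \<zero>\<^bsub>K\<^esub>"
    using x by (simp add: eigenspace_def op_add op_smult pp smult_r_minus ml M.l_neg)
  moreover have "x = ?x' \<oplus>\<^bsub>M\<^esub> ?x''"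
    using x by (simp add: M.r_neg1)
  ultimately show ?thesis
    using that by blast
qed

lemma eigenspace_decomposition:
  assumes l: "l \<in> Units K" and qi: "quasi_idempotent l M p"
  shows "module_decomposition K M (eigenspace M p (\<ominus>\<^bsub>K\<^esub> l)) (eigenspace M p \<zero>\<^bsub>K\<^esub>)"
    and "multiple_of_projection (\<ominus>\<^bsub>K\<^esub> l) M (eigenspace M p (\<ominus>\<^bsub>K\<^esub> l)) (eigenspace M p \<zero>\<^bsub>K\<^esub>) p"
proof -
  let ?E = "eigenspace M p (\<ominus>\<^bsub>K\<^esub> l)" and ?F = "eigenspace M p \<zero>\<^bsub>K\<^esub>"
  have lK [simp]: "l \<in> carrier K"
    using l by auto
  have "?E <+>\<^bsub>M\<^esub> ?F = carrier M"
  proof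
    show "?E <+>\<^bsub>M\<^esub> ?F \<subseteq> carrier M"
      by (auto simp: set_add_def' eigenspace_def)
    show "carrier M \<subseteq> ?E <+>\<^bsub>M\<^esub> ?F"
    proof
      fix x assume "x \<in> carrier M"
      then obtain x' x'' where "x' \<in> ?E" "x'' \<in> ?F" "x = x' \<oplus>\<^bsub>M\<^esub> x''"
        by (rule eigen_split[OF l qi])
      then show "x \<in> ?E <+>\<^bsub>M\<^esub> ?F"
        by (auto simp: set_add_def')
    qed
  qed
  moreover have "?E \<inter> ?F = {\<zero>\<^bsub>M\<^esub>}"
  proof
    show "{\<zero>\<^bsub>M\<^esub>} \<subseteq> ?E \<inter> ?F"
      by (simp add: eigenspace_def)
    show "?E \<inter> ?F \<subseteq> {\<zero>\<^bsub>M\<^esub>}"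
    proof
      fix x assume "x \<in> ?E \<inter> ?F"
      then have x: "x \<in> carrier M" and neg: "p x = \<ominus>\<^bsub>K\<^esub> l \<odot>\<^bsub>M\<^esub> x"
        and null: "p x = \<zero>\<^bsub>K\<^esub> \<odot>\<^bsub>M\<^esub> x"
        by (auto simp only: eigenspace_def)
      \<comment> \<open>On the intersection \<open>p x\<close> is both \<open>-l x\<close> and zero.
        Zero is written as \<open>-l\<close> times zero so that cancellation applies.\<close>
      have "\<ominus>\<^bsub>K\<^esub> l \<odot>\<^bsub>M\<^esub> x = \<ominus>\<^bsub>K\<^esub> l \<odot>\<^bsub>M\<^esub> \<zero>\<^bsub>M\<^esub>"
        using x null unfolding neg[symmetric] by simp
      then show "x \<in> {\<zero>\<^bsub>M\<^esub>}"
        using Units_neg_smult_cancel[OF l x M.zero_closed] by simp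
    qed
  qed
  ultimately show "module_decomposition K M ?E ?F"
    by (auto simp: module_decomposition_def eigenspace_submodule)
  show "multiple_of_projection (\<ominus>\<^bsub>K\<^esub> l) M ?E ?F p"
    by (auto simp: multiple_of_projection_def eigenspace_def op_add)
qed

text \<open>The operator is \<open>-l\<close> on \<open>M'\<close> and zero on \<open>M''\<close>,
  which puts both summands inside the eigenspaces. Conversely, for \<open>x = y + z\<close> the
  value \<open>p x = -l y\<close> determines \<open>y\<close>, since \<open>-l\<close> can be
  cancelled.\<close>

lemma projection_eigenspaces:
  assumes l: "l \<in> Units K" and dec: "module_decomposition K M M' M''"
    and proj: "multiple_of_projection (\<ominus>\<^bsub>K\<^esub> l) M M' M'' p"
  shows "M' = eigenspace M p (\<ominus>\<^bsub>K\<^esub> l)" and "M'' = eigenspace M p \<zero>\<^bsub>K\<^esub>"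
    and "quasi_idempotent l M p"
proof -
  have lK [simp]: "l \<in> carrier K"
    using l by auto
  have sub: "submodule M' K M" "submodule M'' K M"
    using dec by (auto simp: module_decomposition_def)
  have M' [simp]: "x \<in> carrier M" if "x \<in> M'" for x
    using that submoduleE(1)[OF sub(1)] by auto
  have M'' [simp]: "x \<in> carrier M" if "x \<in> M''" for x
    using that submoduleE(1)[OF sub(2)] by auto
  have zero: "\<zero>\<^bsub>M\<^esub> \<in> M'" "\<zero>\<^bsub>M\<^esub> \<in> M''"
    using dec by (auto simp: module_decomposition_def)
  have p: "p (x \<oplus>\<^bsub>M\<^esub> y) = \<ominus>\<^bsub>K\<^esub> l \<odot>\<^bsub>M\<^esub> x" if "x \<in> M'" "y \<in> M''" for x y
    using that proj by (auto simp: multiple_of_projection_def)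
  \<comment> \<open>Setting one component to zero turns the projection formula into a formula on
    each summand.\<close>
  have p': "p x = \<ominus>\<^bsub>K\<^esub> l \<odot>\<^bsub>M\<^esub> x" if "x \<in> M'" for x
    using p[OF that zero(2)] that by simp
  have p'': "p x = \<zero>\<^bsub>M\<^esub>" if "x \<in> M''" for x
    using p[OF zero(1) that] that by simp
  have split: "\<exists>y\<in>M'. \<exists>z\<in>M''. x = y \<oplus>\<^bsub>M\<^esub> z" if "x \<in> carrier M" for x
  proof -
    have "x \<in> M' <+>\<^bsub>M\<^esub> M''"
      using that dec by (simp add: module_decomposition_def)
    then show ?thesis
      by (auto simp: set_add_def')
  qed
  show "M' = eigenspace M p (\<ominus>\<^bsub>K\<^esub> l)"
  proof (intro equalityI subsetI)
    fix x assume x: "x \<in> eigenspace M p (\<ominus>\<^bsub>K\<^esub> l)"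
    then have xM: "x \<in> carrier M"
      by (simp add: eigenspace_def)
    then obtain y z where yz: "y \<in> M'" "z \<in> M''" "x = y \<oplus>\<^bsub>M\<^esub> z"
      using split by blast
    \<comment> \<open>Both sides are \<open>p x\<close>: the left one by the projection formula, the
      right one because \<open>x\<close> is an eigenvector.\<close>
    then have "\<ominus>\<^bsub>K\<^esub> l \<odot>\<^bsub>M\<^esub> y = \<ominus>\<^bsub>K\<^esub> l \<odot>\<^bsub>M\<^esub> x"
      using x p[OF yz(1,2)] xM M'[OF yz(1)] unfolding yz(3)[symmetric] by (simp add: eigenspace_def)
    then have "y = x"
      by (rule Units_neg_smult_cancel[OF l M'[OF yz(1)] xM])
    then show "x \<in> M'"
      using yz by simp
  qed (simp add: eigenspace_def p')
  show "M'' = eigenspace M p \<zero>\<^bsub>K\<^esub>"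
  proof (intro equalityI subsetI)
    fix x assume x: "x \<in> eigenspace M p \<zero>\<^bsub>K\<^esub>"
    then have xM: "x \<in> carrier M"
      by (simp add: eigenspace_def)
    then obtain y z where yz: "y \<in> M'" "z \<in> M''" "x = y \<oplus>\<^bsub>M\<^esub> z"
      using split by blast
    \<comment> \<open>Now \<open>p x\<close> is zero, so the component \<open>y\<close> vanishes and
      \<open>x\<close> is its component \<open>z\<close> in \<open>M''\<close>.\<close>
    then have "\<ominus>\<^bsub>K\<^esub> l \<odot>\<^bsub>M\<^esub> y = \<ominus>\<^bsub>K\<^esub> l \<odot>\<^bsub>M\<^esub> \<zero>\<^bsub>M\<^esub>"
      using x p[OF yz(1,2)] xM M'[OF yz(1)] unfolding yz(3)[symmetric] by (simp add: eigenspace_def)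
    then have "y = \<zero>\<^bsub>M\<^esub>"
      by (rule Units_neg_smult_cancel[OF l M'[OF yz(1)] M.zero_closed])
    then show "x \<in> M''"
      using yz by simp
  qed (simp add: eigenspace_def p'')
  show "quasi_idempotent l M p"
    unfolding quasi_idempotent_iff[OF lK]
  proof
    fix x assume "x \<in> carrier M"
    then obtain y z where yz: "y \<in> M'" "z \<in> M''" "x = y \<oplus>\<^bsub>M\<^esub> z"
      using split by blast
    \<comment> \<open>Here \<open>p x = -l y\<close> with \<open>y\<close> in \<open>M'\<close>, so
      by linearity and \<open>p'\<close> another application of \<open>p\<close> multiplies by
      \<open>-l\<close> once more.\<close>
    then show "p (p x) = \<ominus>\<^bsub>K\<^esub> l \<odot>\<^bsub>M\<^esub> p x"
      by (simp add: p op_smult p')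
  qed
qed

lemma quasi_idempotent_iff_decomposition:
  assumes "l \<in> Units K"
  shows "quasi_idempotent l M p \<longleftrightarrow>
    (\<exists>M' M''. module_decomposition K M M' M'' \<and>
      multiple_of_projection (\<ominus>\<^bsub>K\<^esub> l) M M' M'' p)"
  using eigenspace_decomposition[OF assms] projection_eigenspaces(3)[OF assms] by blast

end

section \<open>The Rota-Baxter identity for a bilinear map\<close>

text \<open>Multiplication in an algebra and the action of an algebra on a module are both instances of
  the bilinear map \<open>f\<close> below.\<close>

locale bilinear_with_operators =
  V: linear_endomorphism K V P + M: linear_endomorphism K M p
  for K :: "('k, 'c) ring_scheme"
    and V :: "('k, 'v, 'd) module_scheme" and P
    and M :: "('k, 'm, 'e) module_scheme" and p +
  fixes f :: "'v \<Rightarrow> 'm \<Rightarrow> 'm"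
  assumes f_closed [simp, intro]:
      "a \<in> carrier V \<Longrightarrow> x \<in> carrier M \<Longrightarrow> f a x \<in> carrier M"
    and f_add_left: "a \<in> carrier V \<Longrightarrow> b \<in> carrier V \<Longrightarrow> x \<in> carrier M \<Longrightarrow>
      f (a \<oplus>\<^bsub>V\<^esub> b) x = f a x \<oplus>\<^bsub>M\<^esub> f b x"
    and f_add_right: "a \<in> carrier V \<Longrightarrow> x \<in> carrier M \<Longrightarrow> y \<in> carrier M \<Longrightarrow>
      f a (x \<oplus>\<^bsub>M\<^esub> y) = f a x \<oplus>\<^bsub>M\<^esub> f a y"
    and f_smult_left: "c \<in> carrier K \<Longrightarrow> a \<in> carrier V \<Longrightarrow> x \<in> carrier M \<Longrightarrow>
      f (c \<odot>\<^bsub>V\<^esub> a) x = c \<odot>\<^bsub>M\<^esub> f a x"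
    and f_smult_right: "c \<in> carrier K \<Longrightarrow> a \<in> carrier V \<Longrightarrow> x \<in> carrier M \<Longrightarrow>
      f a (c \<odot>\<^bsub>M\<^esub> x) = c \<odot>\<^bsub>M\<^esub> f a x"
begin

text \<open>With \<open>f\<close> the multiplication this is the identity of a Rota-Baxter operator,
  with \<open>f\<close> the action that of a Rota-Baxter module. It is stated for a single pair so
  that each kind of eigenvector pair can be treated separately.\<close>

definition rb_identity :: "'k \<Rightarrow> 'v \<Rightarrow> 'm \<Rightarrow> bool" where
  "rb_identity l a x \<longleftrightarrow>
    f (P a) (p x) = p (f a (p x)) \<oplus>\<^bsub>M\<^esub> p (f (P a) x) \<oplus>\<^bsub>M\<^esub> (l \<odot>\<^bsub>M\<^esub> p (f a x))"

lemma f_zero_left [simp]: "x \<in> carrier M \<Longrightarrow> f \<zero>\<^bsub>V\<^esub> x = \<zero>\<^bsub>M\<^esub>"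
  using f_smult_left[of "\<zero>\<^bsub>K\<^esub>" "\<zero>\<^bsub>V\<^esub>" x] by simp

lemma f_zero_right [simp]: "a \<in> carrier V \<Longrightarrow> f a \<zero>\<^bsub>M\<^esub> = \<zero>\<^bsub>M\<^esub>"
  using f_smult_right[of "\<zero>\<^bsub>K\<^esub>" a "\<zero>\<^bsub>M\<^esub>"] by simp

lemma f_neg_left: "a \<in> carrier V \<Longrightarrow> x \<in> carrier M \<Longrightarrow> f (\<ominus>\<^bsub>V\<^esub> a) x = \<ominus>\<^bsub>M\<^esub> f a x"
  using f_smult_left[of "\<ominus>\<^bsub>K\<^esub> \<one>\<^bsub>K\<^esub>" a x] by (simp add: V.smult_l_minus M.smult_l_minus)

lemma f_neg_right: "a \<in> carrier V \<Longrightarrow> x \<in> carrier M \<Longrightarrow> f a (\<ominus>\<^bsub>M\<^esub> x) = \<ominus>\<^bsub>M\<^esub> f a x"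
  using f_smult_right[of "\<ominus>\<^bsub>K\<^esub> \<one>\<^bsub>K\<^esub>" a x] by (simp add: M.smult_l_minus)

lemma rb_identity_add_left:
  assumes "l \<in> carrier K" "a \<in> carrier V" "b \<in> carrier V" "x \<in> carrier M"
    and "rb_identity l a x" "rb_identity l b x"
  shows "rb_identity l (a \<oplus>\<^bsub>V\<^esub> b) x"
proof -
  \<comment> \<open>The left side is expanded first, so that it contains the two products that the
    assumed identities rewrite.\<close>
  have "f (P (a \<oplus>\<^bsub>V\<^esub> b)) (p x) = f (P a) (p x) \<oplus>\<^bsub>M\<^esub> f (P b) (p x)"
    using assms(1-4) by (simp add: V.op_add f_add_left)
  then show ?thesis
    using assms(1-4) unfolding assms(5,6)[unfolded rb_identity_def] rb_identity_def
    by (simp add: f_add_left V.op_add M.op_add M.smult_r_distr M.M.add3_add3)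
qed

lemma rb_identity_add_right:
  assumes "l \<in> carrier K" "a \<in> carrier V" "x \<in> carrier M" "y \<in> carrier M"
    and "rb_identity l a x" "rb_identity l a y"
  shows "rb_identity l a (x \<oplus>\<^bsub>M\<^esub> y)"
proof -
  have "f (P a) (p (x \<oplus>\<^bsub>M\<^esub> y)) = f (P a) (p x) \<oplus>\<^bsub>M\<^esub> f (P a) (p y)"
    using assms(1-4) by (simp add: M.op_add f_add_right)
  then show ?thesis
    using assms(1-4) unfolding assms(5,6)[unfolded rb_identity_def] rb_identity_def
    by (simp add: f_add_right M.op_add M.smult_r_distr M.M.add3_add3)
qed

text \<open>Put \<open>y = f a x\<close>. The left side is \<open>l (l y)\<close>. On the right, two
  terms are \<open>-l (p y)\<close> and the third is \<open>l (p y)\<close>, which leaves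
  \<open>-l (p y)\<close>. Cancelling one factor \<open>l\<close> gives
  \<open>p y = -l y\<close>.\<close>

lemma rb_identity_neg_eigen_iff:
  assumes l: "l \<in> Units K"
    and a: "a \<in> eigenspace V P (\<ominus>\<^bsub>K\<^esub> l)" and x: "x \<in> eigenspace M p (\<ominus>\<^bsub>K\<^esub> l)"
  shows "rb_identity l a x \<longleftrightarrow> f a x \<in> eigenspace M p (\<ominus>\<^bsub>K\<^esub> l)"
proof -
  have lK [simp]: "l \<in> carrier K"
    using l by auto
  have aV [simp]: "a \<in> carrier V" "x \<in> carrier M"
    and Pa: "P a = \<ominus>\<^bsub>K\<^esub> l \<odot>\<^bsub>V\<^esub> a" and px: "p x = \<ominus>\<^bsub>K\<^esub> l \<odot>\<^bsub>M\<^esub> x"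
    using a x by (auto simp: eigenspace_def)
  have "rb_identity l a x \<longleftrightarrow> l \<odot>\<^bsub>M\<^esub> (l \<odot>\<^bsub>M\<^esub> f a x) = l \<odot>\<^bsub>M\<^esub> (\<ominus>\<^bsub>M\<^esub> p (f a x))"
    by (simp add: rb_identity_def Pa px f_smult_left f_smult_right f_neg_left f_neg_right M.op_smult
        V.smult_l_minus M.smult_l_minus M.op_neg M.M.a_assoc M.M.l_neg M.smult_r_minus)
  also have "\<dots> \<longleftrightarrow> l \<odot>\<^bsub>M\<^esub> f a x = \<ominus>\<^bsub>M\<^esub> p (f a x)"
    by (rule M.Units_smult_eq_iff[OF l]) auto
  also have "\<dots> \<longleftrightarrow> p (f a x) = \<ominus>\<^bsub>K\<^esub> l \<odot>\<^bsub>M\<^esub> f a x"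
    by (auto simp: M.smult_l_minus)
  finally show ?thesis
    by (simp add: eigenspace_def)
qed

text \<open>All terms that contain \<open>P a\<close> or \<open>p x\<close> vanish. What remains is
  that \<open>l\<close> times \<open>p (f a x)\<close> is zero, and \<open>l\<close>
  cancels.\<close>

lemma rb_identity_null_iff:
  assumes l: "l \<in> Units K" and a: "a \<in> eigenspace V P \<zero>\<^bsub>K\<^esub>" and x: "x \<in> eigenspace M p \<zero>\<^bsub>K\<^esub>"
  shows "rb_identity l a x \<longleftrightarrow> f a x \<in> eigenspace M p \<zero>\<^bsub>K\<^esub>"
proof -
  have lK [simp]: "l \<in> carrier K"
    using l by auto
  have aV [simp]: "a \<in> carrier V" "x \<in> carrier M"
    and Pa: "P a = \<zero>\<^bsub>V\<^esub>" and px: "p x = \<zero>\<^bsub>M\<^esub>"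
    using a x by (auto simp: eigenspace_def)
  have "rb_identity l a x \<longleftrightarrow> l \<odot>\<^bsub>M\<^esub> \<zero>\<^bsub>M\<^esub> = l \<odot>\<^bsub>M\<^esub> p (f a x)"
    by (simp add: rb_identity_def Pa px)
  also have "\<dots> \<longleftrightarrow> \<zero>\<^bsub>M\<^esub> = p (f a x)"
    by (rule M.Units_smult_eq_iff[OF l]) auto
  finally show ?thesis
    by (auto simp: eigenspace_def)
qed

text \<open>One of \<open>P a\<close> and \<open>p x\<close> is zero, so the left side and one of
  the first two terms on the right vanish. The two surviving terms are \<open>-l p (f a x)\<close>
  and \<open>l p (f a x)\<close>, which cancel.\<close>

lemma rb_identity_mixed:
  assumes l: "l \<in> carrier K"
    and ax: "a \<in> eigenspace V P (\<ominus>\<^bsub>K\<^esub> l) \<and> x \<in> eigenspace M p \<zero>\<^bsub>K\<^esub> \<or>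
      a \<in> eigenspace V P \<zero>\<^bsub>K\<^esub> \<and> x \<in> eigenspace M p (\<ominus>\<^bsub>K\<^esub> l)"
  shows "rb_identity l a x"
  using l ax
  by (auto simp: rb_identity_def eigenspace_def f_smult_left f_smult_right f_neg_left f_neg_right
      V.smult_l_minus M.smult_l_minus M.op_smult M.op_neg M.M.l_neg)

text \<open>The common source of the subalgebra criterion for operators and the stability criterion
  for modules.\<close>

lemma rb_identity_iff_stable:
  assumes l: "l \<in> Units K" and qP: "quasi_idempotent l V P" and qp: "quasi_idempotent l M p"
  shows "(\<forall>a\<in>carrier V. \<forall>x\<in>carrier M. rb_identity l a x) \<longleftrightarrow>
    (\<forall>a\<in>eigenspace V P (\<ominus>\<^bsub>K\<^esub> l). \<forall>x\<in>eigenspace M p (\<ominus>\<^bsub>K\<^esub> l).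
      f a x \<in> eigenspace M p (\<ominus>\<^bsub>K\<^esub> l)) \<and>
    (\<forall>a\<in>eigenspace V P \<zero>\<^bsub>K\<^esub>. \<forall>x\<in>eigenspace M p \<zero>\<^bsub>K\<^esub>. f a x \<in> eigenspace M p \<zero>\<^bsub>K\<^esub>)"
    (is "?rb \<longleftrightarrow> ?st")
proof
  have eV: "a \<in> carrier V" if "a \<in> eigenspace V P c" for a c
    using that by (simp add: eigenspace_def)
  have eM: "x \<in> carrier M" if "x \<in> eigenspace M p c" for x c
    using that by (simp add: eigenspace_def)
  show ?st if ?rb
    using that rb_identity_neg_eigen_iff[OF l] rb_identity_null_iff[OF l] eV eM by blast
  show ?rb if st: ?st
  proof (intro ballI)
    fix a x
    assume "a \<in> carrier V" "x \<in> carrier M"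
    then obtain a' a'' x' x'' where
      a: "a' \<in> eigenspace V P (\<ominus>\<^bsub>K\<^esub> l)" "a'' \<in> eigenspace V P \<zero>\<^bsub>K\<^esub>" "a = a' \<oplus>\<^bsub>V\<^esub> a''" and
      x: "x' \<in> eigenspace M p (\<ominus>\<^bsub>K\<^esub> l)" "x'' \<in> eigenspace M p \<zero>\<^bsub>K\<^esub>" "x = x' \<oplus>\<^bsub>M\<^esub> x''"
      using V.eigen_split[OF l qP] M.eigen_split[OF l qp] by metis
    have lK: "l \<in> carrier K"
      using l by auto
    \<comment> \<open>The components form four pairs: stability settles the two with matching
      eigenvalues, and the mixed ones need no assumption on \<open>f a x\<close>.\<close>
    have "rb_identity l a' x'" "rb_identity l a'' x''"
      using st a x rb_identity_neg_eigen_iff[OF l] rb_identity_null_iff[OF l] by auto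
    moreover have "rb_identity l a' x''" "rb_identity l a'' x'"
      using rb_identity_mixed[OF lK] a x by auto
    ultimately show "rb_identity l a x"
      unfolding a(3) x(3)
      by (intro rb_identity_add_left rb_identity_add_right lK V.M.a_closed M.M.a_closed
          eV[OF a(1)] eV[OF a(2)] eM[OF x(1)] eM[OF x(2)])
  qed
qed

end

section \<open>Restriction of scalars, and the two instances of the bilinear map\<close>

lemma restrict_scalars_simps [simp]:
  "carrier (restrict_scalars R M) = carrier M"
  "zero (restrict_scalars R M) = zero M"
  "add (restrict_scalars R M) = add M"
  "smult (restrict_scalars R M) c x = (c \<odot>\<^bsub>R\<^esub> \<one>\<^bsub>R\<^esub>) \<odot>\<^bsub>M\<^esub> x"
  by (simp_all add: restrict_scalars_def)

lemma restrict_scalars_module: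
  assumes "assoc_algebra K R" "left_module R M"
  shows "module K (restrict_scalars R M)"
proof -
  interpret A: assoc_algebra K R by fact
  interpret L: left_module R M by fact
  show ?thesis
  proof (rule moduleI)
    show "cring K" ..
    show "abelian_group (restrict_scalars R M)"
    proof (rule abelian_groupI)
      show "\<exists>y\<in>carrier (restrict_scalars R M).
          y \<oplus>\<^bsub>restrict_scalars R M\<^esub> x = \<zero>\<^bsub>restrict_scalars R M\<^esub>"
        if "x \<in> carrier (restrict_scalars R M)" for x
        using that L.M.l_neg by auto
    qed (auto simp: L.M.a_ac)
  \<comment> \<open>Associativity of the restricted scalars rests on
    \<open>(c 1) (d 1) = (c d) 1\<close>, a consequence of \<open>A.smult_mult_left\<close> and
    \<open>A.smult_assoc1\<close>.\<close>
  qed (auto simp: L.smult_closed L.smult_l_distr L.smult_r_distr L.smult_one A.smult_l_distr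
      A.smult_assoc1 A.smult_mult_left L.smult_assoc[symmetric])
qed

lemma (in assoc_algebra) bilinear_mult:
  assumes "linear_operator K R P"
  shows "bilinear_with_operators K R P R P (mult R)"
  by unfold_locales
    (rule assms m_closed l_distr r_distr smult_mult_left smult_mult_right; assumption)+

text \<open>A scalar \<open>c\<close> acts on the module as the algebra element \<open>c 1\<close>.
  Homogeneity in the first argument comes from \<open>(c 1) a = c a\<close>, and in the second from
  \<open>a (c 1) = c a\<close>; together these say that \<open>c 1\<close> is central.\<close>

lemma bilinear_action:
  assumes "assoc_algebra K R" "linear_operator K R P"
    and "left_module R M" "linear_operator K (restrict_scalars R M) p"
  shows "bilinear_with_operators K R P (restrict_scalars R M) p (smult M)"
proof -
  interpret A: assoc_algebra K R by fact
  interpret L: left_module R M by fact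
  interpret RM: module K "restrict_scalars R M"
    using assms by (intro restrict_scalars_module)
  show ?thesis
  proof (unfold_locales, simp_all only: restrict_scalars_simps)
    show "linear_operator K R P" "linear_operator K (restrict_scalars R M) p"
      by fact+
  next
    fix c a x
    assume c: "c \<in> carrier K" and a: "a \<in> carrier R" and x: "x \<in> carrier M"
    have c1: "c \<odot>\<^bsub>R\<^esub> \<one>\<^bsub>R\<^esub> \<in> carrier R"
      using c by simp
    have "(c \<odot>\<^bsub>R\<^esub> \<one>\<^bsub>R\<^esub>) \<otimes>\<^bsub>R\<^esub> a = c \<odot>\<^bsub>R\<^esub> a"
      using c a by (simp add: A.smult_mult_left)
    then show left: "(c \<odot>\<^bsub>R\<^esub> a) \<odot>\<^bsub>M\<^esub> x = (c \<odot>\<^bsub>R\<^esub> \<one>\<^bsub>R\<^esub>) \<odot>\<^bsub>M\<^esub> (a \<odot>\<^bsub>M\<^esub> x)"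
      using L.smult_assoc[OF c1 a x] by simp
    have "a \<otimes>\<^bsub>R\<^esub> (c \<odot>\<^bsub>R\<^esub> \<one>\<^bsub>R\<^esub>) = c \<odot>\<^bsub>R\<^esub> a"
      using c a by (simp add: A.smult_mult_right)
    then show "a \<odot>\<^bsub>M\<^esub> ((c \<odot>\<^bsub>R\<^esub> \<one>\<^bsub>R\<^esub>) \<odot>\<^bsub>M\<^esub> x) = (c \<odot>\<^bsub>R\<^esub> \<one>\<^bsub>R\<^esub>) \<odot>\<^bsub>M\<^esub> (a \<odot>\<^bsub>M\<^esub> x)"
      using L.smult_assoc[OF a c1 x] left by simp
  qed (rule L.smult_closed L.smult_l_distr L.smult_r_distr; assumption)+
qed

section \<open>Criteria for Rota-Baxter operators, Rota-Baxter modules and quasi-idempotency\<close>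

text \<open>Eigenspaces are submodules in any case, so being a subalgebra amounts to closure under
  products, which is stability for \<open>f\<close> the multiplication.\<close>

lemma rota_baxter_operator_iff_subalgebras:
  assumes "assoc_algebra K R" "linear_operator K R P" "l \<in> Units K" "quasi_idempotent l R P"
  shows "rota_baxter_operator K l R P \<longleftrightarrow>
    nonunitary_subalgebra K R (eigenspace R P (\<ominus>\<^bsub>K\<^esub> l)) \<and>
    nonunitary_subalgebra K R (eigenspace R P \<zero>\<^bsub>K\<^esub>)"
proof -
  interpret A: assoc_algebra K R by fact
  interpret B: bilinear_with_operators K R P R P "mult R"
    by (rule A.bilinear_mult) fact
  show ?thesis
    using B.rb_identity_iff_stable assms B.V.eigenspace_submodule A.R.Units_closed[OF assms(3)]
    by (simp add: rota_baxter_operator_def nonunitary_subalgebra_def B.rb_identity_def)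
qed

lemma rota_baxter_module_iff_stable:
  assumes "rota_baxter_algebra K l R P" "l \<in> Units K" "quasi_idempotent l R P"
    and "left_module R M" "linear_operator K (restrict_scalars R M) p"
    and "quasi_idempotent l (restrict_scalars R M) p"
  shows "rota_baxter_module K l R P M p \<longleftrightarrow>
    stable_under M (eigenspace R P (\<ominus>\<^bsub>K\<^esub> l))
      (eigenspace (restrict_scalars R M) p (\<ominus>\<^bsub>K\<^esub> l)) \<and>
    stable_under M (eigenspace R P \<zero>\<^bsub>K\<^esub>) (eigenspace (restrict_scalars R M) p \<zero>\<^bsub>K\<^esub>)"
proof -
  interpret B: bilinear_with_operators K R P "restrict_scalars R M" p "smult M"
    using assms
    by (intro bilinear_action) (auto simp: rota_baxter_algebra_def rota_baxter_operator_def)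
  show ?thesis
    using B.rb_identity_iff_stable assms
    by (simp add: rota_baxter_module_def stable_under_def B.rb_identity_def)
qed

lemma rota_baxter_module_quasi_idempotent_iff:
  assumes "rota_baxter_algebra K l R P" "rota_baxter_module K l R P M p" "l \<in> carrier K"
  shows "quasi_idempotent l (restrict_scalars R M) p \<longleftrightarrow>
    (\<forall>x\<in>carrier M. p (P \<one>\<^bsub>R\<^esub> \<odot>\<^bsub>M\<^esub> x) = P \<one>\<^bsub>R\<^esub> \<odot>\<^bsub>M\<^esub> p x)"
proof -
  interpret A: assoc_algebra K R
    using assms by (simp add: rota_baxter_algebra_def)
  interpret L: left_module R M
    using assms by (simp add: rota_baxter_module_def)
  interpret B: bilinear_with_operators K R P "restrict_scalars R M" p "smult M"
    using assms
    by (intro bilinear_action)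
      (auto simp: rota_baxter_algebra_def rota_baxter_operator_def rota_baxter_module_def)
  have closed: "p y \<in> carrier M" if "y \<in> carrier M" for y
    using that B.M.op_closed by simp
  have "p (p x) \<oplus>\<^bsub>M\<^esub> (l \<odot>\<^bsub>R\<^esub> \<one>\<^bsub>R\<^esub>) \<odot>\<^bsub>M\<^esub> p x = \<zero>\<^bsub>M\<^esub> \<longleftrightarrow>
      p (P \<one>\<^bsub>R\<^esub> \<odot>\<^bsub>M\<^esub> x) = P \<one>\<^bsub>R\<^esub> \<odot>\<^bsub>M\<^esub> p x" if x: "x \<in> carrier M" for x
  proof (rule L.M.add_outer_eq_zero_iff)
    \<comment> \<open>With the unit as algebra element, the outer terms on the right reduce to
      \<open>p (p x)\<close> and \<open>l p x\<close>, the two terms of quasi-idempotency.\<close>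
    have "P \<one>\<^bsub>R\<^esub> \<odot>\<^bsub>M\<^esub> p x = p (\<one>\<^bsub>R\<^esub> \<odot>\<^bsub>M\<^esub> p x) \<oplus>\<^bsub>M\<^esub> p (P \<one>\<^bsub>R\<^esub> \<odot>\<^bsub>M\<^esub> x) \<oplus>\<^bsub>M\<^esub>
        (l \<odot>\<^bsub>R\<^esub> \<one>\<^bsub>R\<^esub>) \<odot>\<^bsub>M\<^esub> p (\<one>\<^bsub>R\<^esub> \<odot>\<^bsub>M\<^esub> x)"
      using assms x by (simp add: rota_baxter_module_def)
    then show "P \<one>\<^bsub>R\<^esub> \<odot>\<^bsub>M\<^esub> p x =
        p (p x) \<oplus>\<^bsub>M\<^esub> p (P \<one>\<^bsub>R\<^esub> \<odot>\<^bsub>M\<^esub> x) \<oplus>\<^bsub>M\<^esub> (l \<odot>\<^bsub>R\<^esub> \<one>\<^bsub>R\<^esub>) \<odot>\<^bsub>M\<^esub> p x"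
      using x closed by (simp add: L.smult_one)
  qed (use x assms in \<open>auto simp: closed L.smult_closed\<close>)
  then show ?thesis
    by (simp add: quasi_idempotent_def)
qed

text \<open>This is not the preceding lemma read for \<open>M = R\<close>: there the unit is the
  left argument of the identity, here it is the right one, so \<open>P 1\<close> appears as a right
  factor.\<close>

lemma rota_baxter_algebra_quasi_idempotent_iff:
  assumes "rota_baxter_algebra K l R P" "l \<in> carrier K"
  shows "quasi_idempotent l R P \<longleftrightarrow>
    (\<forall>u\<in>carrier R. P (u \<otimes>\<^bsub>R\<^esub> P \<one>\<^bsub>R\<^esub>) = P u \<otimes>\<^bsub>R\<^esub> P \<one>\<^bsub>R\<^esub>)"
proof -
  interpret A: assoc_algebra K R
    using assms by (simp add: rota_baxter_algebra_def)
  interpret linear_endomorphism K R P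
    using assms by unfold_locales (simp add: rota_baxter_algebra_def rota_baxter_operator_def)
  have "P (P u) \<oplus>\<^bsub>R\<^esub> l \<odot>\<^bsub>R\<^esub> P u = \<zero>\<^bsub>R\<^esub> \<longleftrightarrow>
      P (u \<otimes>\<^bsub>R\<^esub> P \<one>\<^bsub>R\<^esub>) = P u \<otimes>\<^bsub>R\<^esub> P \<one>\<^bsub>R\<^esub>" if u: "u \<in> carrier R" for u
  proof (rule A.M.add_outer_eq_zero_iff)
    have "P u \<otimes>\<^bsub>R\<^esub> P \<one>\<^bsub>R\<^esub> = P (u \<otimes>\<^bsub>R\<^esub> P \<one>\<^bsub>R\<^esub>) \<oplus>\<^bsub>R\<^esub> P (P u \<otimes>\<^bsub>R\<^esub> \<one>\<^bsub>R\<^esub>) \<oplus>\<^bsub>R\<^esub>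
        l \<odot>\<^bsub>R\<^esub> P (u \<otimes>\<^bsub>R\<^esub> \<one>\<^bsub>R\<^esub>)"
      using assms u by (simp add: rota_baxter_algebra_def rota_baxter_operator_def)
    \<comment> \<open>The first two terms are exchanged, which brings \<open>P (u P 1)\<close> into
      the middle position that \<open>add_outer_eq_zero_iff\<close> singles out.\<close>
    then show "P u \<otimes>\<^bsub>R\<^esub> P \<one>\<^bsub>R\<^esub> =
        P (P u) \<oplus>\<^bsub>R\<^esub> P (u \<otimes>\<^bsub>R\<^esub> P \<one>\<^bsub>R\<^esub>) \<oplus>\<^bsub>R\<^esub> l \<odot>\<^bsub>R\<^esub> P u"
      using u assms by (simp add: A.M.a_ac)
  qed (use u assms in auto)
  then show ?thesis
    by (simp add: quasi_idempotent_def)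
qed

section \<open>The four statements together\<close>

theorem proposition2p3:
  fixes K :: "('k, 'c) ring_scheme" and l :: 'k
  assumes "cring K" and "l \<in> carrier K"
  shows
    "(l \<in> Units K \<longrightarrow>
       (\<forall>(M :: ('k, 'm, 'd) module_scheme) p.
          module K M \<and> linear_operator K M p \<longrightarrow>
          (quasi_idempotent l M p \<longleftrightarrow>
             (\<exists>M' M''. module_decomposition K M M' M'' \<and>
                multiple_of_projection (\<ominus>\<^bsub>K\<^esub> l) M M' M'' p)) \<and>
          (\<forall>M' M''. module_decomposition K M M' M'' \<and>
                multiple_of_projection (\<ominus>\<^bsub>K\<^esub> l) M M' M'' p \<longrightarrow>
             M' = eigenspace M p (\<ominus>\<^bsub>K\<^esub> l) \<and> M'' = eigenspace M p \<zero>\<^bsub>K\<^esub>)))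
     \<and>
     (\<forall>(R :: ('k, 'r, 'e) module_scheme) P.
        rota_baxter_algebra K l R P \<longrightarrow>
        (\<forall>(M :: ('r, 'n, 'f) module_scheme) p.
           rota_baxter_module K l R P M p \<longrightarrow>
           (quasi_idempotent l (restrict_scalars R M) p \<longleftrightarrow>
              (\<forall>x\<in>carrier M. p (P \<one>\<^bsub>R\<^esub> \<odot>\<^bsub>M\<^esub> x) = P \<one>\<^bsub>R\<^esub> \<odot>\<^bsub>M\<^esub> p x))) \<and>
        (quasi_idempotent l R P \<longleftrightarrow>
           (\<forall>u\<in>carrier R. P (u \<otimes>\<^bsub>R\<^esub> P \<one>\<^bsub>R\<^esub>) = P u \<otimes>\<^bsub>R\<^esub> P \<one>\<^bsub>R\<^esub>)))
     \<and>
     (l \<in> Units K \<longrightarrow>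
       (\<forall>(R :: ('k, 'r, 'e) module_scheme) P.
          assoc_algebra K R \<and> linear_operator K R P \<longrightarrow>
          (rota_baxter_operator K l R P \<and> quasi_idempotent l R P \<longleftrightarrow>
             (\<exists>R' R''. module_decomposition K R R' R'' \<and>
                nonunitary_subalgebra K R R' \<and> nonunitary_subalgebra K R R'' \<and>
                multiple_of_projection (\<ominus>\<^bsub>K\<^esub> l) R R' R'' P)) \<and>
          (\<forall>R' R''. module_decomposition K R R' R'' \<and>
                nonunitary_subalgebra K R R' \<and> nonunitary_subalgebra K R R'' \<and>
                multiple_of_projection (\<ominus>\<^bsub>K\<^esub> l) R R' R'' P \<longrightarrow>
             R' = eigenspace R P (\<ominus>\<^bsub>K\<^esub> l) \<and> R'' = eigenspace R P \<zero>\<^bsub>K\<^esub>)))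
     \<and>
     (l \<in> Units K \<longrightarrow>
       (\<forall>(R :: ('k, 'r, 'e) module_scheme) P (M :: ('r, 'n, 'f) module_scheme) p.
          rota_baxter_algebra K l R P \<and> quasi_idempotent l R P \<and>
          left_module R M \<and> linear_operator K (restrict_scalars R M) p \<and>
          quasi_idempotent l (restrict_scalars R M) p \<longrightarrow>
          (rota_baxter_module K l R P M p \<longleftrightarrow>
             stable_under M (eigenspace R P (\<ominus>\<^bsub>K\<^esub> l))
               (eigenspace (restrict_scalars R M) p (\<ominus>\<^bsub>K\<^esub> l)) \<and>
             stable_under M (eigenspace R P \<zero>\<^bsub>K\<^esub>)
               (eigenspace (restrict_scalars R M) p \<zero>\<^bsub>K\<^esub>))))"
proof (intro conjI impI allI; (elim conjE)?)
  fix M :: "('k, 'm, 'd) module_scheme" and p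
  assume l: "l \<in> Units K" and M: "module K M" "linear_operator K M p"
  interpret linear_endomorphism K M p
    using M by (simp add: linear_endomorphism_def linear_endomorphism_axioms_def)
  show "quasi_idempotent l M p \<longleftrightarrow> (\<exists>M' M''. module_decomposition K M M' M'' \<and>
      multiple_of_projection (\<ominus>\<^bsub>K\<^esub> l) M M' M'' p)"
    using l by (rule quasi_idempotent_iff_decomposition)
  fix M' M''
  assume "module_decomposition K M M' M''" "multiple_of_projection (\<ominus>\<^bsub>K\<^esub> l) M M' M'' p"
  from projection_eigenspaces[OF l this]
  show "M' = eigenspace M p (\<ominus>\<^bsub>K\<^esub> l)" "M'' = eigenspace M p \<zero>\<^bsub>K\<^esub>"
    by blast+
next
  fix R :: "('k, 'r, 'e) module_scheme" and P
  assume R: "rota_baxter_algebra K l R P"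
  show "quasi_idempotent l R P \<longleftrightarrow>
      (\<forall>u\<in>carrier R. P (u \<otimes>\<^bsub>R\<^esub> P \<one>\<^bsub>R\<^esub>) = P u \<otimes>\<^bsub>R\<^esub> P \<one>\<^bsub>R\<^esub>)"
    using R assms(2) by (rule rota_baxter_algebra_quasi_idempotent_iff)
  fix M :: "('r, 'n, 'f) module_scheme" and p
  assume "rota_baxter_module K l R P M p"
  from rota_baxter_module_quasi_idempotent_iff[OF R this assms(2)]
  show "quasi_idempotent l (restrict_scalars R M) p \<longleftrightarrow>
      (\<forall>x\<in>carrier M. p (P \<one>\<^bsub>R\<^esub> \<odot>\<^bsub>M\<^esub> x) = P \<one>\<^bsub>R\<^esub> \<odot>\<^bsub>M\<^esub> p x)" .
next
  fix R :: "('k, 'r, 'e) module_scheme" and P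
  assume l: "l \<in> Units K" and R: "assoc_algebra K R" "linear_operator K R P"
  interpret assoc_algebra K R by fact
  interpret linear_endomorphism K R P
    using R by unfold_locales
  show "rota_baxter_operator K l R P \<and> quasi_idempotent l R P \<longleftrightarrow>
      (\<exists>R' R''. module_decomposition K R R' R'' \<and>
        nonunitary_subalgebra K R R' \<and> nonunitary_subalgebra K R R'' \<and>
        multiple_of_projection (\<ominus>\<^bsub>K\<^esub> l) R R' R'' P)" (is "?rb \<longleftrightarrow> ?dec")
  proof
    \<comment> \<open>The eigenspaces for \<open>-l\<close> and zero are the witnesses for
      \<open>R'\<close> and \<open>R''\<close>.\<close>
    show ?dec if ?rb
      using that eigenspace_decomposition[OF l] rota_baxter_operator_iff_subalgebras[OF R l]
      by blast
    \<comment> \<open>The projection formula forces \<open>R'\<close> and \<open>R''\<close> to be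
      the eigenspaces, so these are subalgebras and the criterion for operators applies.\<close>
    show ?rb if ?dec
      using that projection_eigenspaces[OF l] rota_baxter_operator_iff_subalgebras[OF R l]
      by metis
  qed
  fix R' R''
  assume "module_decomposition K R R' R''" "multiple_of_projection (\<ominus>\<^bsub>K\<^esub> l) R R' R'' P"
  from projection_eigenspaces[OF l this]
  show "R' = eigenspace R P (\<ominus>\<^bsub>K\<^esub> l)" "R'' = eigenspace R P \<zero>\<^bsub>K\<^esub>"
    by blast+
next
  fix R :: "('k, 'r, 'e) module_scheme" and P and M :: "('r, 'n, 'f) module_scheme" and p
  assume "l \<in> Units K" "rota_baxter_algebra K l R P" "quasi_idempotent l R P"
    "left_module R M" "linear_operator K (restrict_scalars R M) p"
    "quasi_idempotent l (restrict_scalars R M) p"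
  then show "rota_baxter_module K l R P M p \<longleftrightarrow>
      stable_under M (eigenspace R P (\<ominus>\<^bsub>K\<^esub> l))
        (eigenspace (restrict_scalars R M) p (\<ominus>\<^bsub>K\<^esub> l)) \<and>
      stable_under M (eigenspace R P \<zero>\<^bsub>K\<^esub>) (eigenspace (restrict_scalars R M) p \<zero>\<^bsub>K\<^esub>)"
    by (intro rota_baxter_module_iff_stable)
qed

end
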